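(* Let $\mathbb{K}$ be $\mathbb{R}$ or $\mathbb{C}$. Then $\theta\mathbb{K}$ is a compact $T_1$ space.
   Context: $\mathbb{K}$ carries its usual topology. $\mathcal{D}(\mathbb{K})$ is the collection of all closed discrete subsets of $\mathbb{K}$ together with the special member $\mathbb{K}$ itself. A discrete $z$-filter on $\mathbb{K}$ is a collection $\mathcal{F}$ of members of $\mathcal{D}(\mathbb{K})$ such that $\emptyset\notin\mathcal{F}$; $D_1,D_2\in\mathcal{F}$ implies $D_1\cap D_2\in\mathcal{F}$; and $D_1\in\mathcal{F}$, $D\in\mathcal{D}(\mathbb{K})$, $D_1\subseteq D$ imply $D\in\mathcal{F}$. A discrete $z$-ultrafilter is a discrete $z$-filter that is maximal under inclusion. $\theta\mathbb{K}$ is the set of all discrete $z$-ultrafilters on $\mathbb{K}$, regarded as an index set: $\mathcal{D}^p$ is the discrete $z$-ultrafilter corresponding to the point $p\in\theta\mathbb{K}$. It is topologized by taking as basic closed sets the sets $\overline{Z}=\{p\in\theta\mathbb{K}: Z\in\mathcal{D}^p\}$, for $Z$ a closed discrete subset of $\mathbb{K}$. Compact means every open cover has a finite subcover (no Hausdorff condition). *)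

theory Defs
  imports "HOL-Analysis.Analysis"
begin

text \<open>The space \<open>\<bbbK>\<close> is the whole type \<^typ>\<open>'a\<close>, so \<open>\<bbbK>\<close> itself is \<^term>\<open>UNIV\<close>.\<close>

definition closed_discrete_sets :: "'a::topological_space set set" where
  "closed_discrete_sets = {D. closed D \<and> discrete D}"

definition discrete_zsets :: "'a::topological_space set set" where
  "discrete_zsets = insert UNIV closed_discrete_sets"

definition discrete_zfilter :: "'a::topological_space set set \<Rightarrow> bool" where
  "discrete_zfilter F \<longleftrightarrow>
     F \<subseteq> discrete_zsets \<and>
     {} \<notin> F \<and>
     (\<forall>D1\<in>F. \<forall>D2\<in>F. D1 \<inter> D2 \<in> F) \<and>
     (\<forall>D1\<in>F. \<forall>D\<in>discrete_zsets. D1 \<subseteq> D \<longrightarrow> D \<in> F)"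

definition discrete_zultrafilter :: "'a::topological_space set set \<Rightarrow> bool" where
  "discrete_zultrafilter F \<longleftrightarrow>
     discrete_zfilter F \<and> (\<forall>G. discrete_zfilter G \<longrightarrow> F \<subseteq> G \<longrightarrow> G = F)"

text \<open>The ultrafilters themselves serve as the points \<open>p\<close>, so that \<open>\<D>\<^sup>p = p\<close>.\<close>

definition theta_points :: "'a::topological_space set set set" where
  "theta_points = {p. discrete_zultrafilter p}"

definition theta_basic_closed :: "'a::topological_space set \<Rightarrow> 'a set set set" where
  "theta_basic_closed Z = {p \<in> theta_points. Z \<in> p}"

text \<open>The sets \<^term>\<open>theta_basic_closed Z\<close> with \<open>Z\<close> closed discrete are a base for the closed
  sets: their complements are a base for the open sets. That they really form one, so that
  \<^const>\<open>topology\<close> does not return an unspecified value, is \<open>istopology_theta\<close> below.\<close>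

definition theta_space :: "'a::topological_space set set topology" where
  "theta_space = topology (arbitrary union_of
     (\<lambda>U. \<exists>Z\<in>closed_discrete_sets. U = theta_points - theta_basic_closed Z))"

lemma closed_discrete_sets_Un:
  assumes "A \<in> closed_discrete_sets" "B \<in> closed_discrete_sets"
  shows "A \<union> B \<in> closed_discrete_sets"
  using assms
  by (auto simp: closed_discrete_sets_def discrete_def isolated_in_islimpt_iff islimpt_Un
      closed_limpt)

lemma closed_discrete_sets_subset:
  assumes "A \<in> closed_discrete_sets" "B \<subseteq> A" "closed B"
  shows "B \<in> closed_discrete_sets"
  using assms
  by (auto simp: closed_discrete_sets_def discrete_def isolated_in_islimpt_iff
      dest: islimpt_subset)

lemma discrete_zsets_Int:
  assumes "A \<in> discrete_zsets" "B \<in> discrete_zsets"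
  shows "A \<inter> B \<in> discrete_zsets"
proof -
  have cl: "closed C" if "C \<in> discrete_zsets" for C :: "'a set"
    using that by (auto simp: discrete_zsets_def closed_discrete_sets_def)
  show ?thesis
    using assms closed_discrete_sets_subset[of A "A \<inter> B"]
      closed_discrete_sets_subset[of B "A \<inter> B"] cl[OF assms(1)] cl[OF assms(2)]
    by (auto simp: discrete_zsets_def)
qed

lemma discrete_zultrafilter_Un_iff:
  assumes p: "discrete_zultrafilter p"
    and A: "A \<in> closed_discrete_sets" and B: "B \<in> closed_discrete_sets"
  shows "A \<union> B \<in> p \<longleftrightarrow> A \<in> p \<or> B \<in> p"
proof -
  have z: "A \<in> discrete_zsets" "B \<in> discrete_zsets" "A \<union> B \<in> discrete_zsets"
    using A B closed_discrete_sets_Un by (auto simp: discrete_zsets_def)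
  have pf: "discrete_zfilter p"
    and mx: "\<And>G. discrete_zfilter G \<Longrightarrow> p \<subseteq> G \<Longrightarrow> G = p"
    using p by (auto simp: discrete_zultrafilter_def)
  have psub: "p \<subseteq> discrete_zsets"
    and pI: "\<And>C D. C \<in> p \<Longrightarrow> D \<in> p \<Longrightarrow> C \<inter> D \<in> p"
    and pU: "\<And>C D. C \<in> p \<Longrightarrow> D \<in> discrete_zsets \<Longrightarrow> C \<subseteq> D \<Longrightarrow> D \<in> p"
    using pf by (auto simp: discrete_zfilter_def)
  have "B \<in> p" if AB: "A \<union> B \<in> p" and nA: "A \<notin> p"
  proof -
    define G where "G = {E \<in> discrete_zsets. \<exists>D\<in>p. D \<inter> A \<subseteq> E}"
    have pG: "p \<subseteq> G"
      using psub by (auto simp: G_def)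
    have AG: "A \<in> G"
      using z AB by (auto simp: G_def)
    have GI: "E \<inter> E' \<in> G" if "E \<in> G" "E' \<in> G" for E E'
    proof -
      from that obtain D D' where D: "D \<in> p" "D' \<in> p" "D \<inter> A \<subseteq> E" "D' \<inter> A \<subseteq> E'"
        and E: "E \<in> discrete_zsets" "E' \<in> discrete_zsets"
        by (auto simp: G_def)
      have "D \<inter> D' \<in> p" "(D \<inter> D') \<inter> A \<subseteq> E \<inter> E'"
        using D pI by auto
      then show ?thesis
        using discrete_zsets_Int[OF E] by (auto simp: G_def)
    qed
    have GU: "E' \<in> G" if "E \<in> G" "E' \<in> discrete_zsets" "E \<subseteq> E'" for E E'
      using that unfolding G_def by blast
    have "{} \<in> G"
    proof (rule ccontr)
      assume "{} \<notin> G"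
      moreover have "G \<subseteq> discrete_zsets" by (auto simp: G_def)
      ultimately have "discrete_zfilter G"
        unfolding discrete_zfilter_def using GI GU by blast
      then show False using mx pG AG nA by blast
    qed
    then obtain D where D: "D \<in> p" "D \<inter> A = {}"
      by (auto simp: G_def)
    have "D \<inter> (A \<union> B) \<in> p" "D \<inter> (A \<union> B) \<subseteq> B"
      using pI[OF D(1) AB] D(2) by auto
    then show "B \<in> p"
      using pU z by blast
  qed
  then show ?thesis
    using pU z by blast
qed

lemma istopology_theta:
  "istopology (arbitrary union_of
     (\<lambda>U. \<exists>Z\<in>closed_discrete_sets. U = theta_points - theta_basic_closed Z))"
proof (rule istopology_base)
  fix S T :: "'a set set set"
  assume "\<exists>Z\<in>closed_discrete_sets. S = theta_points - theta_basic_closed Z"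
    and "\<exists>Z\<in>closed_discrete_sets. T = theta_points - theta_basic_closed Z"
  then obtain Y Z where Y: "Y \<in> closed_discrete_sets" "S = theta_points - theta_basic_closed Y"
    and Z: "Z \<in> closed_discrete_sets" "T = theta_points - theta_basic_closed Z"
    by blast
  have "S \<inter> T = theta_points - theta_basic_closed (Y \<union> Z)"
    using Y Z discrete_zultrafilter_Un_iff[OF _ Y(1) Z(1)]
    by (auto simp: theta_basic_closed_def theta_points_def)
  then show "\<exists>Z\<in>closed_discrete_sets. S \<inter> T = theta_points - theta_basic_closed Z"
    using closed_discrete_sets_Un[OF Y(1) Z(1)] by blast
qed

lemma openin_theta_space:
  "openin theta_space = arbitrary union_of
     (\<lambda>U. \<exists>Z\<in>closed_discrete_sets. U = theta_points - theta_basic_closed Z)"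
  unfolding theta_space_def by (rule topology_inverse'[OF istopology_theta])

lemma topspace_theta_space: "topspace theta_space = theta_points"
proof -
  have "openin theta_space (theta_points - theta_basic_closed ({} :: 'a set))"
    unfolding openin_theta_space
    by (rule union_of_inc) (auto simp: arbitrary_def closed_discrete_sets_def)
  moreover have "theta_basic_closed ({} :: 'a set) = {}"
    by (auto simp: theta_basic_closed_def theta_points_def discrete_zultrafilter_def
        discrete_zfilter_def)
  moreover have "topspace theta_space \<subseteq> (theta_points :: 'a set set set)"
    using openin_topspace[of "theta_space :: 'a set set topology"]
    unfolding openin_theta_space union_of_def by blast
  ultimately show ?thesis
    using openin_subset by fastforce
qed

end

theory Submission
  imports Defs
begin

text \<open>
  Both properties are formal consequences of the definition of a discrete \<open>z\<close>-ultrafilter and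
  hold over every topological space, so they are proved in that generality
  (\<open>compact_space_theta\<close>, \<open>t1_space_theta\<close>) and then specialised.

  Write \<open>U(Z)\<close> for the basic open set of the ultrafilters that do not contain \<open>Z\<close>.

  Compactness is Zorn's lemma in disguise. In a cover by basic open sets, a finite
  subfamily \<open>U(Z\<^sub>1), \<dots>, U(Z\<^sub>n)\<close> that misses a point \<open>p\<close> gives \<open>Z\<^sub>1, \<dots>, Z\<^sub>n \<in> p\<close>, so that
  \<open>Z\<^sub>1 \<inter> \<dots> \<inter> Z\<^sub>n\<close> is nonempty. If no finite subfamily covers, then the sets \<open>Z\<close> have the finite
  intersection property and lie together in a discrete \<open>z\<close>-ultrafilter; this is a point
  outside every member of the cover. General covers reduce to basic ones by refinement.

  The \<open>T\<^sub>1\<close> property is maximality: distinct ultrafilters \<open>p\<close> and \<open>q\<close> are incomparable, so some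
  \<open>Z\<close> lies in \<open>q\<close> but not in \<open>p\<close>. The whole space lies in every ultrafilter, hence \<open>Z\<close> is an honest
  closed discrete set and \<open>U(Z)\<close> is a basic open neighbourhood of \<open>p\<close> without \<open>q\<close>.
\<close>

lemma discrete_zultrafilter_imp_zfilter:
  "discrete_zultrafilter p \<Longrightarrow> discrete_zfilter p"
  by (simp add: discrete_zultrafilter_def)

lemma openin_theta_basic:
  assumes "Z \<in> closed_discrete_sets"
  shows "openin theta_space (theta_points - theta_basic_closed Z)"
  unfolding openin_theta_space using assms by (intro union_of_inc) (auto simp: arbitrary_def)

lemma openin_theta_space_basicE:
  assumes "openin theta_space U" "p \<in> U"
  obtains Z where "Z \<in> closed_discrete_sets"
    "p \<in> theta_points - theta_basic_closed Z" "theta_points - theta_basic_closed Z \<subseteq> U"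
  using assms unfolding openin_theta_space union_of_def by blast

text \<open>The empty family satisfies the filter axioms as they are stated; it is not maximal, because
  it is properly contained in the filter \<open>{UNIV}\<close>. A nonempty filter contains \<open>UNIV\<close>
  by upward closure.\<close>

lemma UNIV_in_discrete_zultrafilter:
  fixes p :: "'a::topological_space set set"
  assumes "discrete_zultrafilter p"
  shows "UNIV \<in> p"
proof (cases "p = {}")
  case True
  have "discrete_zfilter {UNIV :: 'a set}"
    by (auto simp: discrete_zfilter_def discrete_zsets_def)
  then show ?thesis
    using assms True by (auto simp: discrete_zultrafilter_def)
next
  case False
  then show ?thesis
    using discrete_zultrafilter_imp_zfilter[OF assms]
    by (auto simp: discrete_zfilter_def discrete_zsets_def)
qed

lemma discrete_zfilter_Inter:
  assumes "discrete_zfilter p" "UNIV \<in> p" "finite S" "S \<subseteq> p"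
  shows "\<Inter>S \<in> p"
  using assms(3,4)
proof (induction S rule: finite_induct)
  case empty
  then show ?case using assms(2) by simp
next
  case (insert Z S)
  then show ?case using assms(1) by (simp add: discrete_zfilter_def)
qed

lemma discrete_zfilter_Union_chain:
  assumes C: "C \<noteq> {}" "subset.chain {G. discrete_zfilter G} C"
  shows "discrete_zfilter (\<Union>C)"
proof -
  have filt: "\<And>G. G \<in> C \<Longrightarrow> discrete_zfilter G"
    and lin: "\<And>G H. G \<in> C \<Longrightarrow> H \<in> C \<Longrightarrow> G \<subseteq> H \<or> H \<subseteq> G"
    using C(2) unfolding subset_chain_def by blast+
  have "A \<inter> B \<in> \<Union>C" if AB: "A \<in> G" "G \<in> C" "B \<in> H" "H \<in> C" for A B G H
  proof -
    obtain K where "K \<in> C" "A \<in> K" "B \<in> K"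
      using lin[OF AB(2,4)] AB by blast
    then show ?thesis
      using filt[of K] unfolding discrete_zfilter_def by blast
  qed
  then have Int: "\<forall>A\<in>\<Union>C. \<forall>B\<in>\<Union>C. A \<inter> B \<in> \<Union>C"
    by (metis UnionE)
  have "D \<in> \<Union>C" if AD: "A \<in> \<Union>C" "D \<in> discrete_zsets" "A \<subseteq> D" for A D
  proof -
    obtain G where "G \<in> C" "A \<in> G"
      using AD(1) by blast
    then show ?thesis
      using filt[of G] AD unfolding discrete_zfilter_def by blast
  qed
  moreover have "\<Union>C \<subseteq> discrete_zsets" "{} \<notin> \<Union>C"
    using filt unfolding discrete_zfilter_def by fast+
  ultimately show ?thesis
    using Int unfolding discrete_zfilter_def by simp
qed

lemma discrete_zfilter_extends_to_zultrafilter: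
  assumes F: "discrete_zfilter F"
  obtains p where "discrete_zultrafilter p" "F \<subseteq> p"
proof -
  let ?A = "{G. discrete_zfilter G \<and> F \<subseteq> G}"
  have "\<exists>M\<in>?A. \<forall>X\<in>?A. M \<subseteq> X \<longrightarrow> X = M"
  proof (rule subset_Zorn_nonempty)
    show "?A \<noteq> {}" using F by blast
  next
    fix C assume C: "C \<noteq> {}" "subset.chain ?A C"
    then have "subset.chain {G. discrete_zfilter G} C"
      by (auto simp: subset_chain_def)
    then have "discrete_zfilter (\<Union>C)"
      using C(1) by (rule discrete_zfilter_Union_chain[rotated])
    moreover have "F \<subseteq> \<Union>C"
      using C unfolding subset_chain_def by blast
    ultimately show "\<Union>C \<in> ?A" by blast
  qed
  then obtain p where p: "p \<in> ?A" and max: "\<forall>X\<in>?A. p \<subseteq> X \<longrightarrow> X = p"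
    by (elim bexE)
  have "X = p" if "discrete_zfilter X" "p \<subseteq> X" for X
    using max[rule_format, of X] p that by auto
  then have "discrete_zultrafilter p"
    using p by (simp add: discrete_zultrafilter_def)
  then show ?thesis using p that by simp
qed

text \<open>The filter to extend consists of the members of \<^const>\<open>discrete_zsets\<close> that
  contain a finite intersection of sets from the family; the finite intersection property is
  exactly what keeps the empty set out.\<close>

lemma fip_imp_subset_discrete_zultrafilter:
  assumes B: "B \<subseteq> discrete_zsets"
    and fip: "\<And>S. finite S \<Longrightarrow> S \<subseteq> B \<Longrightarrow> \<Inter>S \<noteq> {}"
  obtains p where "discrete_zultrafilter p" "B \<subseteq> p"
proof -
  define F where "F = {E \<in> discrete_zsets. \<exists>S. finite S \<and> S \<subseteq> B \<and> \<Inter>S \<subseteq> E}"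
  have Int: "E \<inter> E' \<in> F" if "E \<in> F" "E' \<in> F" for E E'
  proof -
    from that obtain S S' where S: "finite S" "S \<subseteq> B" "\<Inter>S \<subseteq> E" "finite S'" "S' \<subseteq> B" "\<Inter>S' \<subseteq> E'"
      and E: "E \<in> discrete_zsets" "E' \<in> discrete_zsets"
      by (auto simp: F_def)
    have "finite (S \<union> S')" "S \<union> S' \<subseteq> B" "\<Inter>(S \<union> S') \<subseteq> E \<inter> E'"
      using S by auto
    then show ?thesis
      using discrete_zsets_Int[OF E] unfolding F_def by blast
  qed
  have ne: "{} \<notin> F"
    using fip by (auto simp: F_def)
  have up: "E' \<in> F" if "E \<in> F" "E' \<in> discrete_zsets" "E \<subseteq> E'" for E E'
    using that unfolding F_def by blast
  have "discrete_zfilter F"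
    unfolding discrete_zfilter_def using Int ne up by (auto simp: F_def)
  then obtain p where p: "discrete_zultrafilter p" "F \<subseteq> p"
    by (rule discrete_zfilter_extends_to_zultrafilter)
  have "Z \<in> F" if "Z \<in> B" for Z
  proof -
    have "finite {Z}" "{Z} \<subseteq> B" "\<Inter>{Z} \<subseteq> Z"
      using that by auto
    then show ?thesis
      using that B unfolding F_def by blast
  qed
  then show ?thesis
    using p that by blast
qed

theorem compact_space_theta:
  "compact_space (theta_space :: 'a::topological_space set set topology)"
  unfolding compact_space
proof (intro allI impI, elim conjE)
  fix \<U> :: "'a set set set set"
  assume op: "\<forall>U\<in>\<U>. openin theta_space U"
    and cov: "\<Union>\<U> = topspace theta_space"
  \<comment> \<open>The sets \<open>Z\<close> whose basic open complements refine the cover.\<close>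
  define B where "B = {Z \<in> closed_discrete_sets.
    \<exists>U\<in>\<U>. theta_points - theta_basic_closed Z \<subseteq> U}"
  have Bz: "B \<subseteq> discrete_zsets"
    by (auto simp: B_def discrete_zsets_def)
  have "\<exists>S. finite S \<and> S \<subseteq> B \<and> \<Inter>S = {}"
  proof (rule ccontr)
    assume "\<not> ?thesis"
    then obtain p where p: "discrete_zultrafilter p" "B \<subseteq> p"
      using fip_imp_subset_discrete_zultrafilter[OF Bz] by metis
    then obtain U where U: "U \<in> \<U>" "p \<in> U"
      using cov by (auto simp: topspace_theta_space theta_points_def)
    then obtain Z where "Z \<in> closed_discrete_sets" "p \<in> theta_points - theta_basic_closed Z"
      "theta_points - theta_basic_closed Z \<subseteq> U"
      using op openin_theta_space_basicE by metis
    then have "Z \<in> B" "Z \<notin> p"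
      using U by (auto simp: B_def theta_basic_closed_def)
    then show False using p(2) by blast
  qed
  then obtain S where S: "finite S" "S \<subseteq> B" "\<Inter>S = {}"
    by blast
  have "\<forall>Z\<in>S. \<exists>U\<in>\<U>. theta_points - theta_basic_closed Z \<subseteq> U"
    using S(2) by (auto simp: B_def)
  then obtain u where u: "\<And>Z. Z \<in> S \<Longrightarrow> u Z \<in> \<U>"
    "\<And>Z. Z \<in> S \<Longrightarrow> theta_points - theta_basic_closed Z \<subseteq> u Z"
    by metis
  have "p \<in> \<Union>(u ` S)" if "p \<in> theta_points" for p
  proof -
    have up: "discrete_zultrafilter p"
      using that by (simp add: theta_points_def)
    have "\<Inter>S \<notin> p"
      using S(3) discrete_zultrafilter_imp_zfilter[OF up] by (simp add: discrete_zfilter_def)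
    then have "\<not> S \<subseteq> p"
      using discrete_zfilter_Inter[OF discrete_zultrafilter_imp_zfilter[OF up]
          UNIV_in_discrete_zultrafilter[OF up] S(1)] by blast
    then show ?thesis
      using u(2) that by (auto simp: theta_basic_closed_def)
  qed
  moreover have "\<Union>(u ` S) \<subseteq> topspace theta_space"
    using u(1) cov by blast
  ultimately have "\<Union>(u ` S) = topspace theta_space"
    unfolding topspace_theta_space by blast
  then show "\<exists>\<F>. finite \<F> \<and> \<F> \<subseteq> \<U> \<and> \<Union>\<F> = topspace theta_space"
    using S(1) u(1) by (intro exI[of _ "u ` S"]) auto
qed

theorem t1_space_theta:
  "t1_space (theta_space :: 'a::topological_space set set topology)"
  unfolding t1_space_def topspace_theta_space
proof (intro ballI impI)
  fix p q :: "'a set set"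
  assume pq: "p \<in> theta_points" "q \<in> theta_points" "p \<noteq> q"
  then have p: "discrete_zultrafilter p" and q: "discrete_zultrafilter q"
    by (auto simp: theta_points_def)
  have "\<not> q \<subseteq> p"
    using p q pq(3) by (auto simp: discrete_zultrafilter_def)
  then obtain Z where Z: "Z \<in> q" "Z \<notin> p"
    by blast
  have "Z \<in> discrete_zsets" "Z \<noteq> UNIV"
    using Z discrete_zultrafilter_imp_zfilter[OF q] UNIV_in_discrete_zultrafilter[OF p]
    by (auto simp: discrete_zfilter_def)
  then have "openin theta_space (theta_points - theta_basic_closed Z)"
    by (intro openin_theta_basic) (simp add: discrete_zsets_def)
  moreover have "p \<in> theta_points - theta_basic_closed Z" "q \<notin> theta_points - theta_basic_closed Z"
    using Z pq by (auto simp: theta_basic_closed_def)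
  ultimately show "\<exists>U. openin theta_space U \<and> p \<in> U \<and> q \<notin> U"
    by blast
qed

theorem theorem3p7:
  shows "(compact_space (theta_space :: real set set topology) \<and>
          t1_space (theta_space :: real set set topology)) \<and>
         (compact_space (theta_space :: complex set set topology) \<and>
          t1_space (theta_space :: complex set set topology))"
  by (intro conjI compact_space_theta t1_space_theta)

end
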